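(* Let $n$ be a positive integer and let $0 \le k \le \nu_2(n)+1$, where $\nu_2(n)$ is the exponent of the largest power of $2$ dividing $n$. Then $S := \langle n, n+2^0, n+2^1, \ldots, n+2^k\rangle$ is a numerical semigroup with Frobenius number $$F(S) = \begin{cases} \dfrac{n^2}{2^k} + (k-1)n - 1, & \text{if } k \le \nu_2(n),\\[6pt] \dfrac{n^2}{2^k} + \left(k - \tfrac{3}{2}\right)n - 1, & \text{if } k = \nu_2(n)+1.\end{cases}$$
   Context: $\mathbb{N}$ denotes the nonnegative integers. For positive integers $a_1,\dots,a_m$, $\langle a_1,\dots,a_m\rangle = \{a_1x_1+\dots+a_mx_m : x_i\in\mathbb{N}\}$. A numerical semigroup is a submonoid $S\subseteq\mathbb{N}$ with $\mathbb{N}\setminus S$ finite; its Frobenius number $F(S)$ is the largest integer not in $S$ (with $F(\mathbb{N})=-1$). *)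

theory Defs
  imports Complex_Main "HOL-Computational_Algebra.Primes"
begin

definition generated :: "nat list \<Rightarrow> nat set" where
  "generated as = {(\<Sum>i<length as. as ! i * x i) | x :: nat \<Rightarrow> nat. True}"

definition numerical_semigroup :: "nat set \<Rightarrow> bool" where
  "numerical_semigroup S \<longleftrightarrow>
     0 \<in> S \<and> (\<forall>a\<in>S. \<forall>b\<in>S. a + b \<in> S) \<and> finite (UNIV - S)"

(* The maximum is taken over the integers, so that the case S = UNIV gives -1. *)
definition frobenius_number :: "nat set \<Rightarrow> int" where
  "frobenius_number S = (GREATEST z :: int. z \<notin> int ` S)"

lemma frobenius_number_UNIV: "frobenius_number UNIV = -1"
  unfolding frobenius_number_def
proof (rule Greatest_equality)
  show "- 1 \<notin> range int" by auto
  show "z \<le> - 1" if "z \<notin> range int" for z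
    using that by (metis nonneg_int_cases not_le rangeI zle_diff1_eq diff_0)
qed

end

theory Submission
  imports Defs
begin

text \<open>
  Collecting terms, the elements of \<open>S\<close> are the numbers \<open>n t + j\<close> such that \<open>j\<close> is a sum of at most
  \<open>t\<close> powers \<open>2^0, \<dots>, 2^k\<close>; let \<open>w(j)\<close> be the least number of summands required. If \<open>2^k\<close>
  divides \<open>2 n\<close>, then adding \<open>n\<close> to \<open>j\<close> does not decrease \<open>w\<close>, so \<open>m \<in> S\<close> iff \<open>w(m mod n) \<le> m div n\<close>.
  On the residues below \<open>n\<close>, the maximum of \<open>w\<close> is attained at \<open>n - 1\<close>, so that
  \<open>F(S) = n w(n - 1) - 1\<close>.
\<close>

section \<open>Least number of powers of two with a given sum\<close>

text \<open>The greedy count: the sum of the \<open>k\<close> lowest binary digits of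
  \<open>j\<close>, plus \<open>j div 2 ^ k\<close> copies of the largest power. The next two lemmas
  identify it with the minimum \<open>w(j)\<close>.\<close>

fun pow2_weight :: "nat \<Rightarrow> nat \<Rightarrow> nat" where
  "pow2_weight 0 j = j"
| "pow2_weight (Suc k) j = j mod 2 + pow2_weight k (j div 2)"

text \<open>Minimality, by carrying: trading two summands \<open>1\<close> for one summand
  \<open>2\<close> keeps the total and never raises the count. After all such trades at most one
  \<open>1\<close> remains, and the other summands can be halved.\<close>

lemma pow2_weight_le_sum:
  "pow2_weight k (\<Sum>i\<le>k. 2 ^ i * x i) \<le> (\<Sum>i\<le>k. x i)"
proof (induction k arbitrary: x)
  case 0
  then show ?case by simp
next
  case (Suc k)
  \<comment> \<open>Halved summands after the carry: the \<open>x 0 div 2\<close> merged pairs of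
    ones join the \<open>x 1\<close> twos, and every exponent drops by one.\<close>
  define y where "y i = (if i = 0 then x 1 + x 0 div 2 else x (Suc i))" for i
  have shift: "(\<Sum>i\<le>k. f i * y i) = (\<Sum>i\<le>k. f i * x (Suc i)) + f 0 * (x 0 div 2)"
    for f :: "nat \<Rightarrow> nat"
    by (cases k)
      (simp_all add: y_def sum.atMost_Suc_shift algebra_simps del: sum.atMost_Suc)
  have "(\<Sum>i\<le>Suc k. 2 ^ i * x i) = x 0 + 2 * (\<Sum>i\<le>k. 2 ^ i * x (Suc i))"
    by (simp add: sum.atMost_Suc_shift sum_distrib_left mult.assoc del: sum.atMost_Suc)
  then have "pow2_weight (Suc k) (\<Sum>i\<le>Suc k. 2 ^ i * x i)
      = x 0 mod 2 + pow2_weight k (\<Sum>i\<le>k. 2 ^ i * y i)"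
    using shift[of "\<lambda>i. 2 ^ i"] by (simp add: add.commute del: sum.atMost_Suc)
  also have "\<dots> \<le> x 0 mod 2 + (\<Sum>i\<le>k. y i)"
    using Suc.IH by simp
  also have "\<dots> = x 0 mod 2 + x 0 div 2 + (\<Sum>i\<le>k. x (Suc i))"
    using shift[of "\<lambda>_. 1"] by simp
  also have "\<dots> \<le> x 0 + (\<Sum>i\<le>k. x (Suc i))"
    by presburger
  also have "\<dots> = (\<Sum>i\<le>Suc k. x i)"
    by (simp add: sum.atMost_Suc_shift del: sum.atMost_Suc)
  finally show ?case .
qed

lemma pow2_weight_attained:
  "\<exists>x. (\<Sum>i\<le>k. 2 ^ i * x i) = j \<and> (\<Sum>i\<le>k. x i) = pow2_weight k j"
proof (induction k arbitrary: j)
  case 0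
  show ?case by (rule exI[of _ "\<lambda>_. j"]) simp
next
  case (Suc k)
  obtain x where x: "(\<Sum>i\<le>k. 2 ^ i * x i) = j div 2" "(\<Sum>i\<le>k. x i) = pow2_weight k (j div 2)"
    using Suc.IH by blast
  have "(\<Sum>i\<le>Suc k. 2 ^ i * case_nat (j mod 2) x i) = j mod 2 + 2 * (\<Sum>i\<le>k. 2 ^ i * x i)"
    by (simp add: sum.atMost_Suc_shift sum_distrib_left mult.assoc del: sum.atMost_Suc)
  moreover have "(\<Sum>i\<le>Suc k. case_nat (j mod 2) x i) = j mod 2 + (\<Sum>i\<le>k. x i)"
    by (simp add: sum.atMost_Suc_shift del: sum.atMost_Suc)
  ultimately show ?case
    using x by (intro exI[of _ "case_nat (j mod 2) x"]) simp
qed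

section \<open>Weights when \<open>2 ^ k\<close> divides \<open>2 * n\<close>\<close>

lemma pow2_weight_1: "pow2_weight (Suc 0) j = (j + 1) div 2"
  by simp presburger

text \<open>Drives the inductions on \<open>k\<close> below: from exponent 2 on, \<open>n\<close> is
  even and its half inherits the hypothesis with the exponent lowered by one. At exponent 1
  \<open>n\<close> may be odd, so that case is settled separately by
  \<open>pow2_weight_1\<close>.\<close>

lemma double_half_of_dvd:
  assumes "2 ^ Suc (Suc k) dvd 2 * (n::nat)"
  obtains h where "n = 2 * h" "2 ^ Suc k dvd 2 * h"
proof -
  have "2 ^ Suc k dvd n"
    using assms by simp
  then obtain c where "n = 2 * (2 ^ k * c)"
    by (auto elim!: dvdE)
  then show thesis
    by (intro that) auto
qed

text \<open>Adding an even \<open>n\<close> leaves the last digit of \<open>j\<close> alone and adds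
  \<open>n div 2\<close> to \<open>j div 2\<close>. The descent ends at exponent 1, where the weight
  is \<open>j / 2\<close> rounded up, hence monotone.\<close>

lemma pow2_weight_le_add:
  assumes "2 ^ k dvd 2 * n"
  shows "pow2_weight k j \<le> pow2_weight k (j + n)"
  using assms
proof (induction k arbitrary: j n)
  case (Suc k)
  show ?case
  proof (cases k)
    case 0
    then show ?thesis
      unfolding 0 pow2_weight_1 by (intro div_le_mono) simp
  next
    case (Suc k')
    then obtain h where "n = 2 * h" "2 ^ k dvd 2 * h"
      using Suc.prems double_half_of_dvd by metis
    with Suc.IH[of h "j div 2"] show ?thesis by (simp add: add.commute)
  qed
qed simp

text \<open>For even \<open>n = 2 * h\<close>, the number \<open>n - 1\<close> has last digit 1 and
  half \<open>h - 1\<close>, so it maximizes the digit and, by induction, the weight of the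
  half.\<close>

lemma pow2_weight_le_pred:
  assumes "2 ^ k dvd 2 * n" "r < n"
  shows "pow2_weight k r \<le> pow2_weight k (n - 1)"
  using assms
proof (induction k arbitrary: r n)
  case (Suc k)
  show ?case
  proof (cases k)
    case 0
    then show ?thesis
      using Suc.prems unfolding 0 pow2_weight_1 by (intro div_le_mono) simp
  next
    case (Suc k')
    then obtain h where h: "n = 2 * h" "2 ^ k dvd 2 * h"
      using Suc.prems double_half_of_dvd by metis
    have "r div 2 < h" "(n - 1) div 2 = h - 1" "(n - 1) mod 2 = 1" "r mod 2 \<le> 1"
      using h(1) Suc.prems(2) by presburger+
    with Suc.IH[of h "r div 2"] h(2) show ?thesis
      unfolding pow2_weight.simps by simp
  qed
qed simp

text \<open>Each halving strips a digit 1 from \<open>n - 1\<close> and leaves \<open>d\<close>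
  unchanged. The \<open>+ 1\<close> on the left avoids truncated subtraction.\<close>

lemma pow2_weight_pred:
  assumes "2 * n = 2 ^ k * d" "n > 0"
  shows "pow2_weight k (n - 1) + 1 = d div 2 + k"
  using assms
proof (induction k arbitrary: n)
  case 0
  then show ?case by auto
next
  case (Suc k)
  show ?case
  proof (cases k)
    case 0
    then show ?thesis
      using Suc.prems unfolding 0 pow2_weight_1 by simp
  next
    case (Suc k')
    have "n = 2 * (2 ^ k' * d)"
      using Suc.prems(1) Suc by simp
    then obtain h where h: "n = 2 * h" "2 * h = 2 ^ k * d"
      using Suc by simp
    have "(n - 1) div 2 = h - 1" "(n - 1) mod 2 = 1" "h > 0"
      using h(1) Suc.prems(2) by presburger+
    with Suc.IH[of h] h(2) show ?thesis by simp
  qed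
qed

section \<open>Membership in the semigroup\<close>

abbreviation shifted_powers :: "nat \<Rightarrow> nat \<Rightarrow> nat list" where
  "shifted_powers n k \<equiv> n # map (\<lambda>i. n + 2 ^ i) [0..<k + 1]"

lemma numerical_combination_shifted_powers:
  "(\<Sum>i<length (shifted_powers n k). shifted_powers n k ! i * x i)
    = n * (x 0 + (\<Sum>i\<le>k. x (Suc i))) + (\<Sum>i\<le>k. 2 ^ i * x (Suc i))"
proof -
  have "(\<Sum>i<length (shifted_powers n k). shifted_powers n k ! i * x i)
      = n * x 0 + (\<Sum>i<Suc k. (n + 2 ^ i) * x (Suc i))"
    by (simp add: sum.lessThan_Suc_shift[of _ "Suc k"] del: upt_Suc sum.lessThan_Suc)
  then show ?thesis
    by (simp add: lessThan_Suc_atMost sum.distrib sum_distrib_left algebra_simps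
        del: sum.lessThan_Suc upt_Suc)
qed

lemma mem_generated_shifted_powers_iff:
  assumes "n > 0" "2 ^ k dvd 2 * n"
  shows "m \<in> generated (shifted_powers n k) \<longleftrightarrow> pow2_weight k (m mod n) \<le> m div n"
proof
  assume "m \<in> generated (shifted_powers n k)"
  then obtain x where m: "m = (\<Sum>i<length (shifted_powers n k). shifted_powers n k ! i * x i)"
    unfolding generated_def by blast
  define j t where "j = (\<Sum>i\<le>k. 2 ^ i * x (Suc i))" and "t = x 0 + (\<Sum>i\<le>k. x (Suc i))"
  have mj: "m = n * t + j"
    unfolding j_def t_def m by (rule numerical_combination_shifted_powers)
  \<comment> \<open>\<open>j\<close> may exceed \<open>n\<close>; its residue differs from it by a
    multiple of \<open>n\<close>, which satisfies the same divisibility, so reducing does not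
    increase the weight.\<close>
  have "2 ^ k dvd 2 * (n * (j div n))"
    using assms(2) by (metis dvd_mult2 mult.assoc)
  then have "pow2_weight k (j mod n) \<le> pow2_weight k j"
    using pow2_weight_le_add[of k "n * (j div n)" "j mod n"] by simp
  also have "\<dots> \<le> t"
    using pow2_weight_le_sum[of k "\<lambda>i. x (Suc i)"] by (simp add: j_def t_def)
  also have "t \<le> m div n"
    using mj assms(1) by simp
  finally show "pow2_weight k (m mod n) \<le> m div n"
    using mj by simp
next
  assume le: "pow2_weight k (m mod n) \<le> m div n"
  obtain x where x: "(\<Sum>i\<le>k. 2 ^ i * x i) = m mod n" "(\<Sum>i\<le>k. x i) = pow2_weight k (m mod n)"
    using pow2_weight_attained by blast
  define y where "y = case_nat (m div n - pow2_weight k (m mod n)) x"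
  have "(\<Sum>i<length (shifted_powers n k). shifted_powers n k ! i * y i) = m"
    unfolding numerical_combination_shifted_powers using x le by (simp add: y_def)
  then show "m \<in> generated (shifted_powers n k)"
    unfolding generated_def by blast
qed

section \<open>Cofiniteness and the Frobenius number\<close>

lemma zero_mem_generated: "0 \<in> generated as"
  unfolding generated_def by (auto intro!: exI[of _ "\<lambda>_. 0"])

lemma add_mem_generated:
  assumes "a \<in> generated as" "b \<in> generated as"
  shows "a + b \<in> generated as"
proof -
  obtain x y where "a = (\<Sum>i<length as. as ! i * x i)" "b = (\<Sum>i<length as. as ! i * y i)"
    using assms unfolding generated_def by blast
  then have "a + b = (\<Sum>i<length as. as ! i * (x i + y i))"
    by (simp add: sum.distrib algebra_simps)
  then show ?thesis
    unfolding generated_def by (auto intro!: exI[of _ "\<lambda>i. x i + y i"])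
qed

lemma mem_generated_shifted_powers_if_ge:
  assumes "n > 0" "2 ^ k dvd 2 * n" "n * pow2_weight k (n - 1) \<le> m"
  shows "m \<in> generated (shifted_powers n k)"
proof -
  have "pow2_weight k (m mod n) \<le> pow2_weight k (n - 1)"
    using assms by (intro pow2_weight_le_pred) auto
  also have "\<dots> \<le> m div n"
    using div_le_mono[OF assms(3), of n] assms(1) by simp
  finally show ?thesis
    using mem_generated_shifted_powers_iff assms by blast
qed

lemma numerical_semigroup_shifted_powers:
  assumes "n > 0" "2 ^ k dvd 2 * n"
  shows "numerical_semigroup (generated (shifted_powers n k))"
proof -
  have "UNIV - generated (shifted_powers n k) \<subseteq> {..<n * pow2_weight k (n - 1)}"
    using mem_generated_shifted_powers_if_ge[OF assms] by (meson DiffD2 lessThan_iff not_le subsetI)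
  then have "finite (UNIV - generated (shifted_powers n k))"
    using finite_subset by blast
  then show ?thesis
    unfolding numerical_semigroup_def using zero_mem_generated add_mem_generated by blast
qed

lemma frobenius_number_shifted_powers:
  assumes "n > 0" "2 ^ k dvd 2 * n"
  shows "frobenius_number (generated (shifted_powers n k)) = int (n * pow2_weight k (n - 1)) - 1"
  unfolding frobenius_number_def
proof (rule Greatest_equality)
  let ?W = "pow2_weight k (n - 1)"
  show "int (n * ?W) - 1 \<notin> int ` generated (shifted_powers n k)"
  proof
    assume "int (n * ?W) - 1 \<in> int ` generated (shifted_powers n k)"
    then obtain m where m: "m \<in> generated (shifted_powers n k)" "int (n * ?W) - 1 = int m"
      by blast
    then have "m + 1 = n * ?W" by linarith
    \<comment> \<open>\<open>?W\<close> is positive because \<open>m + 1\<close> is. Then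
      \<open>m\<close> has the residue \<open>n - 1\<close> of weight \<open>?W\<close> but quotient
      only \<open>?W - 1\<close>, so it misses the membership criterion by one.\<close>
    then obtain v where v: "?W = Suc v" by (cases ?W) auto
    with \<open>m + 1 = n * ?W\<close> assms(1) have "m = n - 1 + n * v" by simp
    then have "m mod n = n - 1" "m div n = v"
      using assms(1) by (simp_all del: add_diff_assoc2 diff_add_assoc2)
    with m(1) v show False
      using mem_generated_shifted_powers_iff[OF assms] by simp
  qed
  show "z \<le> int (n * ?W) - 1" if "z \<notin> int ` generated (shifted_powers n k)" for z
  proof (rule ccontr)
    assume "\<not> z \<le> int (n * ?W) - 1"
    then have "int (n * ?W) \<le> z" by linarith
    then obtain m where "z = int m" "n * ?W \<le> m"
      by (metis of_nat_0_le_iff of_nat_le_iff order_trans zero_le_imp_eq_int)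
    with that mem_generated_shifted_powers_if_ge[OF assms] show False by blast
  qed
qed

section \<open>The closed formula\<close>

theorem theorem1p2:
  fixes n k :: nat
  assumes "n > 0"
    and "k \<le> multiplicity 2 n + 1"
  shows "let S = generated (n # map (\<lambda>i. n + 2 ^ i) [0..<k + 1]) in
    numerical_semigroup S \<and>
    (k \<le> multiplicity 2 n \<longrightarrow>
      real_of_int (frobenius_number S) =
        real n ^ 2 / 2 ^ k + (real k - 1) * real n - 1) \<and>
    (k = multiplicity 2 n + 1 \<longrightarrow>
      real_of_int (frobenius_number S) =
        real n ^ 2 / 2 ^ k + (real k - 3 / 2) * real n - 1)"
proof -
  have "(2::nat) ^ k dvd 2 ^ Suc (multiplicity 2 n)"
    using assms(2) by (simp add: le_imp_power_dvd del: power_Suc)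
  also have "\<dots> dvd 2 * n"
    by (simp add: multiplicity_dvd)
  finally have dvd: "2 ^ k dvd 2 * n" .
  \<comment> \<open>Here \<open>d / 2\<close> is \<open>n / 2 ^ k\<close>; the parity of
    \<open>d\<close> separates the two cases of the formula.\<close>
  then obtain d where d: "2 * n = 2 ^ k * d" by blast
  let ?S = "generated (shifted_powers n k)"
  have "frobenius_number ?S = int n * (int (d div 2 + k) - 1) - 1"
  proof -
    have "pow2_weight k (n - 1) = d div 2 + k - 1"
      using pow2_weight_pred[OF d assms(1)] by linarith
    moreover have "1 \<le> d div 2 + k"
      using pow2_weight_pred[OF d assms(1)] by linarith
    ultimately show ?thesis
      unfolding frobenius_number_shifted_powers[OF assms(1) dvd] by (simp add: of_nat_diff)
  qed
  then have F: "real_of_int (frobenius_number ?S)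
      = real n * (real (d div 2) + real k - 1) - 1"
    by simp
  have "2 * real n = 2 ^ k * real d"
    using arg_cong[OF d, of real] by simp
  then have nd: "real n / 2 ^ k = real d / 2"
    by (simp add: field_simps)
  have sq: "real n ^ 2 / 2 ^ k = real n * (real d / 2)"
    unfolding nd[symmetric] by (simp add: power2_eq_square)
  have "real_of_int (frobenius_number ?S) = real n ^ 2 / 2 ^ k + (real k - 1) * real n - 1"
    if "k \<le> multiplicity 2 n"
  proof -
    have "2 ^ k dvd n"
      using that by (rule multiplicity_dvd')
    then have "even d"
      using d by (auto elim!: dvdE)
    then have "real (d div 2) = real d / 2"
      by (auto elim!: evenE)
    then show ?thesis
      unfolding F sq by (simp add: algebra_simps)
  qed
  moreover have "real_of_int (frobenius_number ?S)
      = real n ^ 2 / 2 ^ k + (real k - 3 / 2) * real n - 1"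
    if k: "k = multiplicity 2 n + 1"
  proof -
    have "\<not> 2 ^ k dvd n"
      using k assms(1) by (simp add: power_dvd_iff_le_multiplicity del: power_Suc)
    then have "odd d"
      using d by (auto elim!: evenE)
    \<comment> \<open>For odd \<open>d\<close>, rounding makes \<open>d div 2\<close> smaller than
      \<open>d / 2\<close> by \<open>1 / 2\<close>, which turns \<open>k - 1\<close> into
      \<open>k - 3 / 2\<close>.\<close>
    then obtain c where "d = 2 * c + 1" by (elim oddE)
    then show ?thesis
      unfolding F sq by (simp add: field_simps)
  qed
  ultimately show ?thesis
    using numerical_semigroup_shifted_powers[OF assms(1) dvd] by (simp add: Let_def del: upt_Suc)
qed

end
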